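(* Let $\beta\in(1,2)$ be such that the $\beta$-expansion of $1$ terminates, and let $f_\beta\colon x\mapsto\beta x \bmod 1$. Then for any $x\in[0,1]$ there is an $\alpha>0$ such that the set $$G_{f_\beta}(x)=\Big\{\,y\in[0,1): x\notin\overline{\bigcup_{n=0}^\infty\{f_\beta^n(y)\}}\,\Big\}$$ is $\alpha$-winning in $[0,1]$. In fact $\alpha=\tfrac14$ is small enough, i.e. $G_{f_\beta}(x)$ is $\tfrac14$-winning.
   Context: **$\beta$-expansions.** Let $[t]$ denote the integer part of $t$. For $\beta\in(1,2)$ and $x\in[0,1]$, put $d(x,\beta)=\{d_n(x,\beta)\}_{n=0}^\infty\in\{0,1\}^{\mathbb N}$ with $d_n(x,\beta)=[\beta f_\beta^n(x)]$, where $f_\beta(x)=\beta x\bmod 1$ (and $f_\beta^0(x)=x$). The expansion of $1$ terminates if $d(1,\beta)=j_0\dots j_{k-1}0^\infty$ for some $k$, i.e. $d_n(1,\beta)=0$ for all $n\ge k$. **The game.** To avoid a clash with the base $\beta$, the second game parameter is called $\gamma$. Fix $\alpha,\gamma\in(0,1)$; $|J|$ denotes the length of an interval $J$. The $(\alpha,\gamma)$-game is played on $[0,1]$ by Black and White. First Black chooses any closed (nondegenerate) interval $B_0\subset[0,1]$, and White chooses a closed interval $W_0\subset B_0$ with $|W_0|=\alpha|B_0|$. At step $k\ge1$ Black chooses a closed interval $B_k\subset W_{k-1}$ with $|B_k|=\gamma|W_{k-1}|$, and then White chooses a closed interval $W_k\subset B_k$ with $|W_k|=\alpha|B_k|$.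 The set $\bigcap_k W_k=\bigcap_k B_k$ is a single point. A set $E$ is $(\alpha,\gamma)$-winning if White can always, however Black plays, achieve $\bigcap_{k=0}^\infty W_k\subset E$. A set $E$ is $\alpha$-winning if it is $(\alpha,\gamma)$-winning for all $\gamma\in(0,1)$. *)

theory Defs
  imports "HOL-Analysis.Analysis"
begin

definition beta_map :: "real \<Rightarrow> real \<Rightarrow> real" where
  "beta_map \<beta> x = frac (\<beta> * x)"

definition beta_digit :: "real \<Rightarrow> real \<Rightarrow> nat \<Rightarrow> int" where
  "beta_digit \<beta> x n = \<lfloor>\<beta> * (beta_map \<beta> ^^ n) x\<rfloor>"

definition expansion_of_one_terminates :: "real \<Rightarrow> bool" where
  "expansion_of_one_terminates \<beta> \<longleftrightarrow> (\<exists>k. \<forall>n\<ge>k. beta_digit \<beta> 1 n = 0)"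

definition orbit_avoiding_set :: "(real \<Rightarrow> real) \<Rightarrow> real \<Rightarrow> real set" where
  "orbit_avoiding_set f x = {y \<in> {0..<1}. x \<notin> closure (\<Union>n. {(f ^^ n) y})}"

definition closed_interval :: "real set \<Rightarrow> bool" where
  "closed_interval J \<longleftrightarrow> (\<exists>a b. a < b \<and> J = {a..b})"

text \<open>
  A move inside the interval \<open>I\<close> with ratio \<open>r\<close>; the length of an interval is its Lebesgue measure.
\<close>
definition legal_move :: "real \<Rightarrow> real set \<Rightarrow> real set \<Rightarrow> bool" where
  "legal_move r I J \<longleftrightarrow> closed_interval J \<and> J \<subseteq> I \<and> measure lborel J = r * measure lborel I"

fun black_move_legal :: "real \<Rightarrow> (nat \<Rightarrow> real set) \<Rightarrow> (nat \<Rightarrow> real set) \<Rightarrow> nat \<Rightarrow> bool" where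
  "black_move_legal \<gamma> B W 0 \<longleftrightarrow> closed_interval (B 0) \<and> B 0 \<subseteq> {0..1}"
| "black_move_legal \<gamma> B W (Suc k) \<longleftrightarrow> legal_move \<gamma> (W k) (B (Suc k))"

text \<open>
  A strategy for White maps the list \<open>[B 0, ..., B k]\<close> of Black's moves so far to \<open>W k\<close>;
  White's own earlier moves are determined by that list and the strategy.
\<close>
definition responses :: "(real set list \<Rightarrow> real set) \<Rightarrow> (nat \<Rightarrow> real set) \<Rightarrow> nat \<Rightarrow> real set" where
  "responses \<sigma> B k = \<sigma> (map B [0..<Suc k])"

text \<open>
  White's answer has to be legal after every finite legal history, and not just along
  infinite legal plays: otherwise White could win vacuously by an illegal answer (such as the
  empty set) that leaves Black without a legal move.
\<close>
definition game_winning :: "real \<Rightarrow> real \<Rightarrow> real set \<Rightarrow> bool" where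
  "game_winning \<alpha> \<gamma> E \<longleftrightarrow>
    (\<exists>\<sigma>. \<forall>B.
      (\<forall>k. (\<forall>i\<le>k. black_move_legal \<gamma> B (responses \<sigma> B) i) \<longrightarrow>
            legal_move \<alpha> (B k) (responses \<sigma> B k)) \<and>
      ((\<forall>k. black_move_legal \<gamma> B (responses \<sigma> B) k) \<longrightarrow>
            (\<Inter>k. responses \<sigma> B k) \<subseteq> E))"

definition alpha_winning :: "real \<Rightarrow> real set \<Rightarrow> bool" where
  "alpha_winning \<alpha> E \<longleftrightarrow> (\<forall>\<gamma>. 0 < \<gamma> \<and> \<gamma> < 1 \<longrightarrow> game_winning \<alpha> \<gamma> E)"

end

theory Submission
  imports Defs
begin

text \<open>
  Since the expansion of \<open>1\<close> terminates, cylinders of generation \<open>n\<close> have length at least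
  \<open>\<delta> / \<beta>^n\<close>, so an interval of length below \<open>\<delta> / \<beta>^n\<close> meets at most two of them. Within one
  cylinder, consider the points whose orbit comes \<open>\<epsilon>\<close>-close to \<open>x\<close> at some time in a window
  \<open>n, \<dots>, n + N\<close>. If two such visits occur at different times, then \<open>x\<close> is close to a point that
  returns close to \<open>x\<close>; as \<open>f^m t - \<beta>^m t\<close> takes only finitely many values, this forces
  \<open>f^m\<close> to be the expansion by \<open>\<beta>^m\<close> about \<open>x\<close>, and the later visit implies the earlier one.
  Hence the points to be avoided lie in two tiny intervals, and one of three
  disjoint quarters of Black's interval misses both.
\<close>

section \<open>Cylinders\<close>

text \<open>Cylinders enter only as an equivalence relation on points. No endpoints have to be
  computed, and a lower bound on cylinder lengths becomes a statement about three points.\<close>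

definition same_cylinder :: "real \<Rightarrow> nat \<Rightarrow> real \<Rightarrow> real \<Rightarrow> bool" where
  "same_cylinder \<beta> n y z \<longleftrightarrow> (\<forall>i<n. beta_digit \<beta> y i = beta_digit \<beta> z i)"

lemma same_cylinder_0 [simp]: "same_cylinder \<beta> 0 y z"
  by (simp add: same_cylinder_def)

text \<open>Splitting off the first digit, not the last, lets the inductions on cylinders replace
  points by their images.\<close>

lemma same_cylinder_Suc:
  "same_cylinder \<beta> (Suc n) y z \<longleftrightarrow>
    \<lfloor>\<beta> * y\<rfloor> = \<lfloor>\<beta> * z\<rfloor> \<and> same_cylinder \<beta> n (beta_map \<beta> y) (beta_map \<beta> z)"
  unfolding same_cylinder_def All_less_Suc2 by (simp add: beta_digit_def funpow_swap1)

lemma same_cylinder_mono: "same_cylinder \<beta> n y z \<Longrightarrow> m \<le> n \<Longrightarrow> same_cylinder \<beta> m y z"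
  by (simp add: same_cylinder_def)

lemma same_cylinder_refl: "same_cylinder \<beta> n y y"
  by (simp add: same_cylinder_def)

lemma same_cylinder_sym: "same_cylinder \<beta> n y z \<Longrightarrow> same_cylinder \<beta> n z y"
  by (simp add: same_cylinder_def)

lemma same_cylinder_trans:
  "same_cylinder \<beta> n y z \<Longrightarrow> same_cylinder \<beta> n z w \<Longrightarrow> same_cylinder \<beta> n y w"
  by (simp add: same_cylinder_def)

lemma same_cylinder_funpow_diff:
  assumes "same_cylinder \<beta> n y z"
  shows "(beta_map \<beta> ^^ n) z - (beta_map \<beta> ^^ n) y = \<beta> ^ n * (z - y)"
  using assms
proof (induction n arbitrary: y z)
  case (Suc n)
  then have eq: "\<lfloor>\<beta> * y\<rfloor> = \<lfloor>\<beta> * z\<rfloor>"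
    and "same_cylinder \<beta> n (beta_map \<beta> y) (beta_map \<beta> z)"
    by (simp_all add: same_cylinder_Suc)
  from Suc.IH[OF this(2)] eq show ?case
    by (simp add: funpow_Suc_right beta_map_def frac_def algebra_simps del: funpow.simps(2))
qed simp

lemma beta_map_bounds: "0 \<le> beta_map \<beta> y" "beta_map \<beta> y < 1"
  by (simp_all add: beta_map_def frac_lt_1)

lemma beta_map_funpow_bounds:
  assumes "0 \<le> y" "y < 1"
  shows "0 \<le> (beta_map \<beta> ^^ n) y" "(beta_map \<beta> ^^ n) y < 1"
  using assms by (cases n; simp add: beta_map_bounds)+

lemma floor_less_two_cases:
  fixes t :: real
  assumes "0 \<le> t" "t < 2"
  shows "\<lfloor>t\<rfloor> = 0 \<and> t < 1 \<or> \<lfloor>t\<rfloor> = 1 \<and> 1 \<le> t"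
  using assms by (cases "t < 1") (auto simp: floor_eq_iff)

section \<open>Returns close to a given point\<close>

text \<open>One more iterate multiplies each offset by \<beta> and subtracts one of finitely many
  digits.\<close>

lemma finite_funpow_offsets:
  assumes "1 < \<beta>" "\<beta> < 2"
  shows "finite ((\<lambda>t. (beta_map \<beta> ^^ m) t - \<beta> ^ m * t) ` {0..<1})"
proof (induction m)
  case 0
  have "(\<lambda>t. (beta_map \<beta> ^^ 0) t - \<beta> ^ 0 * t) ` {0..<1} \<subseteq> {0}" by auto
  then show ?case by (rule finite_subset) simp
next
  case (Suc m)
  let ?A = "(\<lambda>t. (beta_map \<beta> ^^ m) t - \<beta> ^ m * t) ` {0..<1}"
  have "(beta_map \<beta> ^^ Suc m) t - \<beta> ^ Suc m * t
      \<in> (\<lambda>(c, d). \<beta> * c - real_of_int d) ` (?A \<times> {0..2})" if t: "t \<in> {0..<1}" for t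
  proof -
    let ?s = "(beta_map \<beta> ^^ m) t"
    have s: "0 \<le> ?s" "?s < 1" using beta_map_funpow_bounds t by auto
    have "\<beta> * ?s < 2" using s assms mult_strict_mono[of \<beta> 2 ?s 1] by simp
    moreover have "0 \<le> \<beta> * ?s" using s assms by simp
    ultimately have "\<lfloor>\<beta> * ?s\<rfloor> \<in> {0..2}" using floor_less_two_cases by force
    moreover have "(beta_map \<beta> ^^ Suc m) t - \<beta> ^ Suc m * t = \<beta> * (?s - \<beta> ^ m * t) - \<lfloor>\<beta> * ?s\<rfloor>"
      by (simp add: beta_map_def frac_def algebra_simps)
    ultimately show ?thesis
      using t by (intro image_eqI[where x = "(?s - \<beta> ^ m * t, \<lfloor>\<beta> * ?s\<rfloor>)"]) auto
  qed
  then have "(\<lambda>t. (beta_map \<beta> ^^ Suc m) t - \<beta> ^ Suc m * t) ` {0..<1}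
      \<subseteq> (\<lambda>(c, d). \<beta> * c - real_of_int d) ` (?A \<times> {0..2})" by blast
  then show ?case by (rule finite_subset) (use Suc in simp)
qed

text \<open>The difference of the two sides of the final equation takes finitely many values, so the
  nonzero ones stay away from 0. If t and its m-th iterate are both close to x, the difference is
  too small to be nonzero.\<close>

lemma near_return_is_expansion:
  assumes "1 < \<beta>" "\<beta> < 2"
  shows "\<exists>\<kappa>>0. \<forall>m\<le>N. \<forall>t. 0 \<le> t \<longrightarrow> t < 1 \<longrightarrow> \<bar>t - x\<bar> < \<kappa> \<longrightarrow>
    \<bar>(beta_map \<beta> ^^ m) t - x\<bar> < \<kappa> \<longrightarrow> (beta_map \<beta> ^^ m) t - x = \<beta> ^ m * (t - x)"
proof -
  let ?S = "\<Union>m\<le>N. (\<lambda>c. c - x + \<beta> ^ m * x) ` (\<lambda>t. (beta_map \<beta> ^^ m) t - \<beta> ^ m * t) ` {0..<1}"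
  have "finite ?S" using finite_funpow_offsets[OF assms] by blast
  from finite_set_avoid[OF this, of 0] obtain g where g: "g > 0"
    "\<And>c. c \<in> ?S \<Longrightarrow> c \<noteq> 0 \<Longrightarrow> g \<le> \<bar>c\<bar>" by (auto simp: dist_real_def)
  \<comment> \<open>Two distances below \<kappa> make the difference smaller than \<kappa> +
    \<beta>^N * \<kappa>, which this choice turns into the gap \<open>g\<close>.\<close>
  define \<kappa> where "\<kappa> = g / (1 + \<beta> ^ N)"
  have pos: "0 < 1 + \<beta> ^ N" using assms by (simp add: add_pos_pos)
  have "(beta_map \<beta> ^^ m) t - x = \<beta> ^ m * (t - x)"
    if m: "m \<le> N" and t: "0 \<le> t" "t < 1" "\<bar>t - x\<bar> < \<kappa>" "\<bar>(beta_map \<beta> ^^ m) t - x\<bar> < \<kappa>" for m t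
  proof (rule ccontr)
    let ?c = "(beta_map \<beta> ^^ m) t - \<beta> ^ m * t - x + \<beta> ^ m * x"
    assume "\<not> ?thesis"
    then have "?c \<noteq> 0" by (simp add: algebra_simps)
    moreover have "?c \<in> ?S" using m t by (intro UN_I[of m] imageI) auto
    ultimately have "g \<le> \<bar>?c\<bar>" using g(2) by blast
    also have "?c = ((beta_map \<beta> ^^ m) t - x) - \<beta> ^ m * (t - x)" by (simp add: algebra_simps)
    also have "\<bar>\<dots>\<bar> \<le> \<bar>(beta_map \<beta> ^^ m) t - x\<bar> + \<bar>\<beta> ^ m * (t - x)\<bar>" by (rule abs_triangle_ineq4)
    also have "\<bar>\<beta> ^ m * (t - x)\<bar> \<le> \<beta> ^ N * \<kappa>"
      unfolding abs_mult using assms m t by (intro mult_mono) auto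
    finally have "g < \<kappa> + \<beta> ^ N * \<kappa>" using t by simp
    also have "\<dots> = \<kappa> * (1 + \<beta> ^ N)" by (simp add: algebra_simps)
    also have "\<dots> = g" using pos by (simp add: \<kappa>_def)
    finally show False by simp
  qed
  moreover have "\<kappa> > 0" using g pos by (simp add: \<kappa>_def)
  ultimately show ?thesis by blast
qed

section \<open>Lower bounds for the lengths of cylinders\<close>

text \<open>Points of [0, 1 / \<beta>^n) have n zero digits, so that interval cannot contain two
  points from different cylinders.\<close>

lemma right_end_of_split_ge:
  assumes "1 < \<beta>" "0 \<le> t" "t < s" "\<not> same_cylinder \<beta> n t s"
  shows "1 / \<beta> ^ n \<le> s"
  using assms
proof (induction n arbitrary: t s)
  case (Suc n)
  have f: "\<lfloor>\<beta> * t\<rfloor> \<le> \<lfloor>\<beta> * s\<rfloor>" "0 \<le> \<lfloor>\<beta> * t\<rfloor>"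
    using Suc.prems by (auto intro!: floor_mono)
  show ?case
  proof (cases "\<lfloor>\<beta> * t\<rfloor> = \<lfloor>\<beta> * s\<rfloor>")
    case True
    then have "\<not> same_cylinder \<beta> n (beta_map \<beta> t) (beta_map \<beta> s)"
      using Suc.prems by (simp add: same_cylinder_Suc)
    moreover have "beta_map \<beta> t < beta_map \<beta> s"
      using True Suc.prems by (simp add: beta_map_def frac_def)
    ultimately have "1 / \<beta> ^ n \<le> beta_map \<beta> s"
      using Suc.IH Suc.prems(1) beta_map_bounds by blast
    also have "\<dots> \<le> \<beta> * s" using f by (simp add: beta_map_def frac_def del: zero_le_floor)
    finally show ?thesis using Suc.prems by (simp add: field_simps)
  next
    case False
    then have "1 \<le> \<lfloor>\<beta> * s\<rfloor>" using f by linarith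
    then have "1 \<le> \<beta> * s" by linarith
    moreover have "1 \<le> \<beta> ^ n" using Suc.prems by simp
    ultimately have "1 \<le> \<beta> * s * \<beta> ^ n" using mult_mono[of 1 "\<beta> * s" 1 "\<beta> ^ n"] by simp
    then show ?thesis using Suc.prems by (simp add: field_simps)
  qed
qed simp

text \<open>This is the left limit of \<open>beta_map\<close> at c: the two agree unless \<beta> * c
  is an integer, where the value is 1 instead of 0.\<close>

definition beta_left_map :: "real \<Rightarrow> real \<Rightarrow> real" where
  "beta_left_map \<beta> c = \<beta> * c - \<lceil>\<beta> * c\<rceil> + 1"

text \<open>
  The set \<open>S\<close> is the orbit of \<open>1\<close> under the left-continuous version of the map, i.e. the
  set of left limits of \<open>f^n\<close> at right ends of cylinders of generation \<open>n\<close>.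
\<close>
lemma left_end_of_split_le:
  assumes \<beta>: "1 < \<beta>" "\<beta> < 2"
    and S: "\<And>c. c \<in> S \<Longrightarrow> \<delta> \<le> c \<and> c \<le> 1 \<and> beta_left_map \<beta> c \<in> S" and "0 < \<delta>"
    and "0 \<le> t" "t < s" "s < c" "c \<in> S" "\<not> same_cylinder \<beta> n t s"
  shows "\<delta> / \<beta> ^ n \<le> c - t"
  using assms(5-)
proof (induction n arbitrary: t s c)
  case (Suc n)
  have c: "c \<le> 1" "\<delta> \<le> beta_left_map \<beta> c" using S Suc.prems by blast+
  have lt: "\<beta> * t < \<beta> * s" "\<beta> * s < \<beta> * c" "0 \<le> \<beta> * t" using Suc.prems \<beta> by auto
  have c2: "\<beta> * c < 2" using \<beta> c Suc.prems mult_less_le_imp_less[of \<beta> 2 c 1] by simp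
  show ?case
  \<comment> \<open>The digit of c is read from the left, as \<lceil>\<beta> * c\<rceil> - 1. While
    all three digits agree, the maps expand the configuration by \<beta> and the right end stays in
    \<open>S\<close>.\<close>
  proof (cases "\<lfloor>\<beta> * t\<rfloor> = \<lfloor>\<beta> * s\<rfloor> \<and> \<lceil>\<beta> * c\<rceil> - 1 = \<lfloor>\<beta> * s\<rfloor>")
    case True
    then have "\<not> same_cylinder \<beta> n (beta_map \<beta> t) (beta_map \<beta> s)"
      using Suc.prems by (simp add: same_cylinder_Suc)
    moreover have ceil: "real_of_int \<lceil>\<beta> * c\<rceil> = \<lfloor>\<beta> * s\<rfloor> + 1" using True by linarith
    have "beta_map \<beta> t < beta_map \<beta> s" "beta_map \<beta> s < beta_left_map \<beta> c"
      and eq: "beta_left_map \<beta> c - beta_map \<beta> t = \<beta> * (c - t)"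
      using True lt ceil by (simp_all add: beta_map_def beta_left_map_def frac_def algebra_simps)
    moreover have "beta_left_map \<beta> c \<in> S" using S Suc.prems by blast
    ultimately have "\<delta> / \<beta> ^ n \<le> \<beta> * (c - t)"
      using Suc.IH[of "beta_map \<beta> t" "beta_map \<beta> s" "beta_left_map \<beta> c"] beta_map_bounds(1)[of \<beta> t]
      by simp
    then show ?thesis using \<beta> by (simp add: field_simps)
  next
    case False
    \<comment> \<open>The break 1 / \<beta> now lies strictly between t and c, and the left map
      sends c to \<beta> * c - 1, a point of \<open>S\<close>.\<close>
    have "\<beta> * t < 1 \<and> \<lceil>\<beta> * c\<rceil> = 2"
      using False lt c2 floor_less_two_cases[of "\<beta> * t"] floor_less_two_cases[of "\<beta> * s"]
      by (cases "\<beta> * c \<le> 1") (auto simp: ceiling_eq_iff)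
    then have "\<delta> \<le> \<beta> * (c - t)" using c by (simp add: beta_left_map_def algebra_simps)
    then have "\<delta> * 1 \<le> \<beta> * (c - t) * \<beta> ^ n"
      using \<beta> \<open>0 < \<delta>\<close> by (intro mult_mono) auto
    then show ?thesis using \<beta> by (simp add: field_simps)
  qed
qed simp

text \<open>The cylinder of the middle point lies between the outer ones, so this bounds its length.
  The points are expanded until the break 1 / \<beta> separates them; the two on the same side of it
  are still in different cylinders.\<close>

lemma three_points_two_cylinders:
  assumes \<beta>: "1 < \<beta>" "\<beta> < 2"
    and S: "\<And>c. c \<in> S \<Longrightarrow> \<delta> \<le> c \<and> c \<le> 1 \<and> beta_left_map \<beta> c \<in> S" "0 < \<delta>" "1 \<in> S"
    and "0 \<le> y1" "y1 < y2" "y2 < y3" "y3 < 1"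
    and "\<not> same_cylinder \<beta> n y1 y2" "\<not> same_cylinder \<beta> n y2 y3"
  shows "\<delta> / \<beta> ^ n \<le> y3 - y1"
  using assms(6-)
proof (induction n arbitrary: y1 y2 y3)
  case (Suc n)
  have lt: "\<beta> * y1 < \<beta> * y2" "\<beta> * y2 < \<beta> * y3" "0 \<le> \<beta> * y1" using Suc.prems \<beta> by auto
  have y3: "\<beta> * y3 < 2" using \<beta> Suc.prems mult_strict_mono[of \<beta> 2 y3 1] by simp
  note nc = Suc.prems(5,6)[unfolded same_cylinder_Suc]
  have scale: "\<delta> / \<beta> ^ n \<le> \<beta> * (y3 - y1) \<Longrightarrow> ?case" using \<beta> by (simp add: field_simps)
  consider (all) "\<lfloor>\<beta> * y1\<rfloor> = \<lfloor>\<beta> * y2\<rfloor>" "\<lfloor>\<beta> * y2\<rfloor> = \<lfloor>\<beta> * y3\<rfloor>"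
    | (left) "\<lfloor>\<beta> * y1\<rfloor> = 0" "\<lfloor>\<beta> * y2\<rfloor> = 1" "\<lfloor>\<beta> * y3\<rfloor> = 1"
    | (right) "\<lfloor>\<beta> * y1\<rfloor> = 0" "\<lfloor>\<beta> * y2\<rfloor> = 0" "\<lfloor>\<beta> * y3\<rfloor> = 1"
    using lt y3 floor_less_two_cases[of "\<beta> * y1"] floor_less_two_cases[of "\<beta> * y2"]
      floor_less_two_cases[of "\<beta> * y3"] by force
  then show ?case
  proof cases
    case all
    have "beta_map \<beta> y1 < beta_map \<beta> y2" "beta_map \<beta> y2 < beta_map \<beta> y3"
      "beta_map \<beta> y3 - beta_map \<beta> y1 = \<beta> * (y3 - y1)"
      using all lt by (simp_all add: beta_map_def frac_def algebra_simps)
    then show ?thesis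
      using Suc.IH[of "beta_map \<beta> y1" "beta_map \<beta> y2" "beta_map \<beta> y3"] nc all
        beta_map_bounds scale by simp
  next
    \<comment> \<open>The branch right of the break has image starting at 0, so the split pair is
      compared with 0.\<close>
    case left
    have "beta_map \<beta> y2 < beta_map \<beta> y3"
      using left lt by (simp add: beta_map_def frac_def)
    then have "1 / \<beta> ^ n \<le> beta_map \<beta> y3"
      using right_end_of_split_ge[OF \<beta>(1) beta_map_bounds(1)] nc left by simp
    also have "\<dots> \<le> \<beta> * (y3 - y1)"
      using left lt by (simp add: beta_map_def frac_def algebra_simps) linarith
    finally have "1 / \<beta> ^ n \<le> \<beta> * (y3 - y1)" .
    moreover have "\<delta> / \<beta> ^ n \<le> 1 / \<beta> ^ n"
      using S \<beta> by (intro divide_right_mono) auto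
    ultimately show ?thesis using scale by linarith
  next
    \<comment> \<open>The branch left of the break has left limit 1 at its right end, so the split
      pair is compared with c = 1.\<close>
    case right
    have "beta_map \<beta> y1 < beta_map \<beta> y2"
      using right lt by (simp add: beta_map_def frac_def)
    then have "\<delta> / \<beta> ^ n \<le> 1 - beta_map \<beta> y1"
      using left_end_of_split_le[OF \<beta> S(1,2) beta_map_bounds(1) _ beta_map_bounds(2) S(3)] nc right
      by simp
    also have "\<dots> \<le> \<beta> * (y3 - y1)"
      using right lt by (simp add: beta_map_def frac_def algebra_simps) linarith
    finally show ?thesis by (rule scale)
  qed
qed simp

text \<open>Once all digits vanish the map is multiplication by \<beta>, which would push a positive
  point beyond 1.\<close>

lemma terminating_orbit_of_one:
  assumes "1 < \<beta>" "expansion_of_one_terminates \<beta>"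
  obtains k where "\<And>n. n \<ge> k \<Longrightarrow> (beta_map \<beta> ^^ n) 1 = 0"
proof -
  obtain k where k: "\<And>n. n \<ge> k \<Longrightarrow> beta_digit \<beta> 1 n = 0"
    using assms unfolding expansion_of_one_terminates_def by blast
  have grow: "(beta_map \<beta> ^^ (n + i)) 1 = \<beta> ^ i * (beta_map \<beta> ^^ n) 1" if "n \<ge> k" for n i
  proof (induction i)
    case (Suc i)
    have "\<lfloor>\<beta> * (beta_map \<beta> ^^ (n + i)) 1\<rfloor> = 0"
      using k[of "n + i"] that by (simp add: beta_digit_def)
    then have "(beta_map \<beta> ^^ (n + Suc i)) 1 = \<beta> * (beta_map \<beta> ^^ (n + i)) 1"
      by (simp add: beta_map_def frac_def)
    then show ?case by (simp add: Suc)
  qed simp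
  \<comment> \<open>Starting at \<open>Suc k\<close> makes the point a value of
    \<open>beta_map\<close>, hence nonnegative.\<close>
  have "(beta_map \<beta> ^^ n) 1 = 0" if "n \<ge> Suc k" for n
  proof (rule ccontr)
    obtain m where m: "n = Suc m" "m \<ge> k" using \<open>n \<ge> Suc k\<close> by (cases n) auto
    assume "(beta_map \<beta> ^^ n) 1 \<noteq> 0"
    then have pos: "(beta_map \<beta> ^^ n) 1 > 0"
      using beta_map_bounds(1)[of \<beta> "(beta_map \<beta> ^^ m) 1"] m by simp
    obtain i where "1 / (beta_map \<beta> ^^ n) 1 < \<beta> ^ i"
      using real_arch_pow[OF assms(1)] by blast
    then have "1 < (beta_map \<beta> ^^ (n + i)) 1"
      using grow[of n i] that pos by (simp add: field_simps)
    moreover have "(beta_map \<beta> ^^ (n + i)) 1 < 1" using m beta_map_bounds(2) by simp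
    ultimately show False by simp
  qed
  then show ?thesis using that by blast
qed

text \<open>Termination makes the orbit of 1 finite, and its least nonzero point serves as
  \<delta>.\<close>

lemma short_interval_two_cylinders:
  assumes \<beta>: "1 < \<beta>" "\<beta> < 2" and "expansion_of_one_terminates \<beta>"
  obtains \<delta> where "0 < \<delta>"
    "\<And>n y1 y2 y3. 0 \<le> y1 \<Longrightarrow> y1 < y2 \<Longrightarrow> y2 < y3 \<Longrightarrow> y3 < 1 \<Longrightarrow> y3 - y1 < \<delta> / \<beta> ^ n \<Longrightarrow>
      same_cylinder \<beta> n y1 y2 \<or> same_cylinder \<beta> n y2 y3"
proof -
  \<comment> \<open>Removing 0 keeps the minimum positive. The set stays closed under the left map,
    which sends a point to 1 whenever \<open>beta_map\<close> sends it to 0.\<close>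
  define S where "S = range (\<lambda>n. (beta_map \<beta> ^^ n) 1) - {0}"
  obtain k where k: "\<And>n. n \<ge> k \<Longrightarrow> (beta_map \<beta> ^^ n) 1 = 0"
    using terminating_orbit_of_one assms by blast
  have "S \<subseteq> (\<lambda>n. (beta_map \<beta> ^^ n) 1) ` {..<k}"
    using k by (auto simp: S_def image_iff) (metis lessThan_iff not_le)
  then have fin: "finite S" by (rule finite_subset) simp
  have one: "1 \<in> S" by (auto simp: S_def intro: range_eqI[of _ _ 0])
  have range: "0 < c \<and> c \<le> 1" if "c \<in> S" for c
  proof -
    obtain n where "c = (beta_map \<beta> ^^ n) 1" "c \<noteq> 0" using \<open>c \<in> S\<close> by (auto simp: S_def)
    then show ?thesis
      using beta_map_bounds[of \<beta>] by (cases n) (auto simp: less_le)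
  qed
  have closed: "beta_left_map \<beta> c \<in> S" if "c \<in> S" for c
  proof -
    obtain n where n: "c = (beta_map \<beta> ^^ n) 1" using \<open>c \<in> S\<close> by (auto simp: S_def)
    show ?thesis
    proof (cases "beta_map \<beta> c = 0")
      case True
      then have "beta_left_map \<beta> c = 1"
        by (simp add: beta_map_def beta_left_map_def frac_def) (metis ceiling_of_int of_int_floor_le)
      then show ?thesis using one by simp
    next
      case False
      then have "\<lceil>\<beta> * c\<rceil> = \<lfloor>\<beta> * c\<rfloor> + 1"
        by (simp add: beta_map_def frac_def ceiling_altdef)
      then have "beta_left_map \<beta> c = (beta_map \<beta> ^^ Suc n) 1"
        by (simp add: beta_map_def beta_left_map_def frac_def flip: n)
      then show ?thesis using False n by (auto simp: S_def beta_left_map_def intro: range_eqI[of _ _ "Suc n"])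
    qed
  qed
  have "Min S \<in> S" using fin one by (intro Min_in) auto
  then have "0 < Min S" using range by blast
  moreover have "\<And>c. c \<in> S \<Longrightarrow> Min S \<le> c \<and> c \<le> 1 \<and> beta_left_map \<beta> c \<in> S"
    using fin range closed by simp
  ultimately show ?thesis
    using three_points_two_cylinders[OF \<beta>, of S "Min S"] one that by (meson not_le)
qed

section \<open>Points coming close to the target\<close>

text \<open>As z stays close to y, the point y also comes near x at time n + j. Its two visits make
  the iterate between them an expansion about x, so z was within \<epsilon> of x already at time n +
  i. Two visits at the same time force y and z together.\<close>

lemma bad_points_cluster_ordered:
  fixes f :: "real \<Rightarrow> real"
  assumes \<beta>: "1 < \<beta>"
    and ret: "\<And>m t. m \<le> N \<Longrightarrow> 0 \<le> t \<Longrightarrow> t < 1 \<Longrightarrow> \<bar>t - x\<bar> < \<kappa> \<Longrightarrow>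
      \<bar>(f ^^ m) t - x\<bar> < \<kappa> \<Longrightarrow> (f ^^ m) t - x = \<beta> ^ m * (t - x)"
    and aff: "\<And>i. i \<le> N \<Longrightarrow> (f ^^ (n + i)) z - (f ^^ (n + i)) y = \<beta> ^ (n + i) * (z - y)"
    and y: "0 \<le> (f ^^ (n + i)) y" "(f ^^ (n + i)) y < 1"
    and \<eta>: "\<eta> * (1 + \<beta> ^ N) \<le> \<kappa>" "0 < \<eta>" "\<epsilon> < \<eta>" "\<bar>z - y\<bar> \<le> \<eta> / \<beta> ^ n"
    and ij: "i \<le> j" "j \<le> N"
    and bad: "\<bar>(f ^^ (n + i)) y - x\<bar> < \<epsilon>" "\<bar>(f ^^ (n + j)) z - x\<bar> < \<epsilon>"
  shows "\<bar>z - y\<bar> \<le> 2 * \<epsilon> / \<beta> ^ n"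
proof -
  define m where "m = j - i"
  define y' z' where "y' = (f ^^ (n + i)) y" and "z' = (f ^^ (n + i)) z"
  have "(f ^^ (n + j)) w = (f ^^ m) ((f ^^ (n + i)) w)" for w
  proof -
    have "n + j = m + (n + i)" using ij by (simp add: m_def)
    then show ?thesis by (simp only: funpow_add o_apply)
  qed
  then have j: "(f ^^ (n + j)) y = (f ^^ m) y'" "(f ^^ (n + j)) z = (f ^^ m) z'"
    by (simp_all add: y'_def z'_def)
  have yz: "z' - y' = \<beta> ^ (n + i) * (z - y)" using aff ij by (simp add: y'_def z'_def)
  have fyz: "(f ^^ m) z' - (f ^^ m) y' = \<beta> ^ m * (z' - y')"
    using aff[of j] ij unfolding j yz by (simp add: m_def add.commute flip: power_add mult.assoc)
  have "\<bar>(f ^^ (n + j)) z - (f ^^ (n + j)) y\<bar> = \<beta> ^ j * (\<beta> ^ n * \<bar>z - y\<bar>)"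
    using aff[of j] ij \<beta> by (simp add: abs_mult power_add)
  also have "\<dots> \<le> \<beta> ^ N * \<eta>"
    using \<beta> \<eta> ij by (intro mult_mono power_increasing) (auto simp: field_simps)
  finally have "\<bar>(f ^^ m) z' - (f ^^ m) y'\<bar> \<le> \<beta> ^ N * \<eta>" by (simp add: j)
  then have "\<bar>(f ^^ m) y' - x\<bar> < \<eta> + \<beta> ^ N * \<eta>"
    using bad(2) \<eta>(3) unfolding j by linarith
  also have "\<dots> \<le> \<kappa>" using \<eta>(1) by (simp add: algebra_simps)
  finally have "\<bar>(f ^^ m) y' - x\<bar> < \<kappa>" .
  moreover have "\<eta> * 1 \<le> \<eta> * (1 + \<beta> ^ N)" using \<eta>(2) \<beta> by (intro mult_left_mono) auto
  then have "\<bar>y' - x\<bar> < \<kappa>" using bad(1) \<eta>(1,3) unfolding y'_def by linarith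
  ultimately have "(f ^^ m) y' - x = \<beta> ^ m * (y' - x)"
    using ret[of m y'] y ij by (simp add: y'_def m_def)
  \<comment> \<open>Affinity carries the expansion about x over from \<open>y'\<close> to
    \<open>z'\<close>.\<close>
  with fyz have "(f ^^ m) z' - x = \<beta> ^ m * (z' - x)" by (simp add: algebra_simps)
  then have "\<beta> ^ m * \<bar>z' - x\<bar> < \<epsilon>" using bad(2) \<beta> unfolding j by (simp add: abs_mult)
  moreover have "1 * \<bar>z' - x\<bar> \<le> \<beta> ^ m * \<bar>z' - x\<bar>" using \<beta> by (intro mult_right_mono) auto
  ultimately have "\<bar>z' - x\<bar> < \<epsilon>" by simp
  then have "\<bar>z' - y'\<bar> \<le> 2 * \<epsilon>" using bad(1) unfolding y'_def[symmetric] by linarith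
  moreover have "\<beta> ^ n * \<bar>z - y\<bar> \<le> \<bar>z' - y'\<bar>"
    unfolding yz abs_mult using \<beta> by (intro mult_mono) auto
  ultimately show ?thesis using \<beta> by (simp add: field_simps)
qed

lemma bad_points_cluster:
  assumes \<beta>: "1 < \<beta>" "\<beta> < 2"
  obtains \<eta> where "0 < \<eta>"
    "\<And>n y z i j \<epsilon>. y \<in> {0..<1} \<Longrightarrow> z \<in> {0..<1} \<Longrightarrow> same_cylinder \<beta> (n + N) y z \<Longrightarrow>
      \<bar>z - y\<bar> \<le> \<eta> / \<beta> ^ n \<Longrightarrow> \<epsilon> < \<eta> \<Longrightarrow> i \<le> N \<Longrightarrow> j \<le> N \<Longrightarrow>
      \<bar>(beta_map \<beta> ^^ (n + i)) y - x\<bar> < \<epsilon> \<Longrightarrow> \<bar>(beta_map \<beta> ^^ (n + j)) z - x\<bar> < \<epsilon> \<Longrightarrow>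
      \<bar>z - y\<bar> \<le> 2 * \<epsilon> / \<beta> ^ n"
proof -
  obtain \<kappa> where \<kappa>: "\<kappa> > 0" "\<And>m t. m \<le> N \<Longrightarrow> 0 \<le> t \<Longrightarrow> t < 1 \<Longrightarrow> \<bar>t - x\<bar> < \<kappa> \<Longrightarrow>
      \<bar>(beta_map \<beta> ^^ m) t - x\<bar> < \<kappa> \<Longrightarrow> (beta_map \<beta> ^^ m) t - x = \<beta> ^ m * (t - x)"
    using near_return_is_expansion[OF \<beta>, of N x] by blast
  define \<eta> where "\<eta> = \<kappa> / (1 + \<beta> ^ N)"
  have pos: "0 < 1 + \<beta> ^ N" using \<beta> by (simp add: add_pos_pos)
  have \<eta>: "0 < \<eta>" "\<eta> * (1 + \<beta> ^ N) \<le> \<kappa>" using pos \<kappa> by (simp_all add: \<eta>_def)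
  have aff: "(beta_map \<beta> ^^ (n + i)) z - (beta_map \<beta> ^^ (n + i)) y = \<beta> ^ (n + i) * (z - y)"
    if "same_cylinder \<beta> (n + N) y z" "i \<le> N" for n y z i
    using that by (intro same_cylinder_funpow_diff) (auto intro: same_cylinder_mono)
  show ?thesis
  proof (rule that[OF \<eta>(1)])
    fix n y z i j \<epsilon>
    assume *: "y \<in> {0..<1}" "z \<in> {0..<1}" "same_cylinder \<beta> (n + N) y z"
      "\<bar>z - y\<bar> \<le> \<eta> / \<beta> ^ n" "\<epsilon> < \<eta>" "i \<le> N" "j \<le> N"
      "\<bar>(beta_map \<beta> ^^ (n + i)) y - x\<bar> < \<epsilon>" "\<bar>(beta_map \<beta> ^^ (n + j)) z - x\<bar> < \<epsilon>"
    show "\<bar>z - y\<bar> \<le> 2 * \<epsilon> / \<beta> ^ n"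
    proof (cases "i \<le> j")
      case True
      show ?thesis
        by (rule bad_points_cluster_ordered[OF \<beta>(1) \<kappa>(2) aff[OF *(3)] _ _ \<eta>(2,1) *(5,4) True *(7-9)])
          (use * beta_map_funpow_bounds in auto)
    next
      \<comment> \<open>Here z makes the earlier visit, so the two points exchange roles.\<close>
      case False
      have zy: "\<bar>y - z\<bar> \<le> \<eta> / \<beta> ^ n" using *(4) by (simp add: abs_minus_commute)
      have "\<bar>y - z\<bar> \<le> 2 * \<epsilon> / \<beta> ^ n"
        by (rule bad_points_cluster_ordered[OF \<beta>(1) \<kappa>(2) aff[OF same_cylinder_sym[OF *(3)]] _ _
              \<eta>(2,1) *(5) zy _ *(6,9,8)])
          (use * False beta_map_funpow_bounds in auto)
      then show ?thesis by (simp add: abs_minus_commute)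
    qed
  qed
qed

text \<open>On a cylinder of generation n + N every iterate in the window is affine, so the bad
  points in it cluster. A short interval meets at most two such cylinders, which gives one ball for
  each.\<close>

lemma bad_points_in_two_balls:
  assumes \<beta>: "1 < \<beta>" "\<beta> < 2" and "expansion_of_one_terminates \<beta>"
  obtains \<eta> where "0 < \<eta>"
    "\<And>n u v \<epsilon>. 0 \<le> u \<Longrightarrow> u < v \<Longrightarrow> v \<le> 1 \<Longrightarrow> v - u \<le> \<eta> / \<beta> ^ n \<Longrightarrow> \<epsilon> < \<eta> \<Longrightarrow>
      \<exists>a b. \<forall>y\<in>{u..v}. y < 1 \<longrightarrow> (\<forall>i\<le>N. \<bar>(beta_map \<beta> ^^ (n + i)) y - x\<bar> < \<epsilon> \<longrightarrow>
        \<bar>y - a\<bar> \<le> 2 * \<epsilon> / \<beta> ^ n \<or> \<bar>y - b\<bar> \<le> 2 * \<epsilon> / \<beta> ^ n)"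
proof -
  obtain \<delta> where \<delta>: "0 < \<delta>"
    "\<And>n y1 y2 y3. 0 \<le> y1 \<Longrightarrow> y1 < y2 \<Longrightarrow> y2 < y3 \<Longrightarrow> y3 < 1 \<Longrightarrow> y3 - y1 < \<delta> / \<beta> ^ n \<Longrightarrow>
      same_cylinder \<beta> n y1 y2 \<or> same_cylinder \<beta> n y2 y3"
    using short_interval_two_cylinders assms by blast
  obtain \<eta>' where \<eta>': "0 < \<eta>'"
    "\<And>n y z i j \<epsilon>. y \<in> {0..<1} \<Longrightarrow> z \<in> {0..<1} \<Longrightarrow> same_cylinder \<beta> (n + N) y z \<Longrightarrow>
      \<bar>z - y\<bar> \<le> \<eta>' / \<beta> ^ n \<Longrightarrow> \<epsilon> < \<eta>' \<Longrightarrow> i \<le> N \<Longrightarrow> j \<le> N \<Longrightarrow>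
      \<bar>(beta_map \<beta> ^^ (n + i)) y - x\<bar> < \<epsilon> \<Longrightarrow> \<bar>(beta_map \<beta> ^^ (n + j)) z - x\<bar> < \<epsilon> \<Longrightarrow>
      \<bar>z - y\<bar> \<le> 2 * \<epsilon> / \<beta> ^ n"
    using bad_points_cluster[OF \<beta>, of N x] by blast
  \<comment> \<open>Division by \<beta>^N pays for passing from generation n to n + N; the factor
    1/2 makes the length bound strict.\<close>
  define \<eta> where "\<eta> = min \<eta>' (\<delta> / \<beta> ^ N / 2)"
  have pos: "0 < \<beta> ^ k" for k using \<beta> by simp
  have \<eta>: "0 < \<eta>" "\<eta> \<le> \<eta>'" "\<eta> < \<delta> / \<beta> ^ N"
    using \<delta>(1) \<eta>'(1) pos[of N] by (auto simp: \<eta>_def min_def field_simps)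
  show ?thesis
  proof (rule that[OF \<eta>(1)])
    fix n u v \<epsilon>
    assume uv: "0 \<le> u" "u < v" "v \<le> 1" "v - u \<le> \<eta> / \<beta> ^ n" and \<epsilon>: "\<epsilon> < \<eta>"
    define bad where "bad = {y \<in> {u..v}. y < 1 \<and> (\<exists>i\<le>N. \<bar>(beta_map \<beta> ^^ (n + i)) y - x\<bar> < \<epsilon>)}"
    have short: "v - u < \<delta> / \<beta> ^ (n + N)"
    proof -
      have "\<eta> / \<beta> ^ n < \<delta> / \<beta> ^ N / \<beta> ^ n" using \<eta>(3) pos by (intro divide_strict_right_mono)
      then show ?thesis using uv(4) by (simp add: power_add mult.commute)
    qed
    have pair: "\<bar>z - y\<bar> \<le> 2 * \<epsilon> / \<beta> ^ n"
      if "y \<in> bad" "z \<in> bad" and cyl: "same_cylinder \<beta> (n + N) y z" for y z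
    proof -
      obtain i j where ij: "i \<le> N" "j \<le> N" "\<bar>(beta_map \<beta> ^^ (n + i)) y - x\<bar> < \<epsilon>"
          "\<bar>(beta_map \<beta> ^^ (n + j)) z - x\<bar> < \<epsilon>"
        using \<open>y \<in> bad\<close> \<open>z \<in> bad\<close> by (auto simp: bad_def)
      have r: "y \<in> {0..<1}" "z \<in> {0..<1}" and "\<bar>z - y\<bar> \<le> v - u"
        using \<open>y \<in> bad\<close> \<open>z \<in> bad\<close> uv by (auto simp: bad_def)
      moreover have "\<eta> / \<beta> ^ n \<le> \<eta>' / \<beta> ^ n" using \<eta>(2) pos[of n] by (intro divide_right_mono) auto
      ultimately have "\<bar>z - y\<bar> \<le> \<eta>' / \<beta> ^ n" using uv(4) by linarith
      then show ?thesis using \<eta>'(2)[OF r cyl _ _ ij] \<epsilon> \<eta>(2) by simp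
    qed
    \<comment> \<open>One of the two cylinders is that of the left end \<open>u\<close>; all
      remaining bad points share the other.\<close>
    have other: "same_cylinder \<beta> (n + N) y z"
      if "y \<in> bad" "z \<in> bad" "\<not> same_cylinder \<beta> (n + N) u y" "\<not> same_cylinder \<beta> (n + N) u z" for y z
    proof -
      have le: "same_cylinder \<beta> (n + N) y z"
        if "y \<in> bad" "z \<in> bad" "\<not> same_cylinder \<beta> (n + N) u y" "y < z" for y z
      proof -
        have "u \<noteq> y" using \<open>\<not> same_cylinder \<beta> (n + N) u y\<close> same_cylinder_refl by metis
        then show ?thesis
          using \<delta>(2)[of u y z "n + N"] that short uv by (auto simp: bad_def)
      qed
      show ?thesis
        using le[of y z] le[of z y] that same_cylinder_refl same_cylinder_sym
        by (metis linorder_neqE_linordered_idom)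
    qed
    define C where "C = {y. same_cylinder \<beta> (n + N) u y}"
    \<comment> \<open>The centres are arbitrary bad points of the two classes, and arbitrary reals
      if a class has none.\<close>
    obtain a where a: "\<And>y. y \<in> bad \<inter> C \<Longrightarrow> a \<in> bad \<inter> C" by blast
    obtain b where b: "\<And>y. y \<in> bad - C \<Longrightarrow> b \<in> bad - C" by blast
    have "\<bar>y - a\<bar> \<le> 2 * \<epsilon> / \<beta> ^ n \<or> \<bar>y - b\<bar> \<le> 2 * \<epsilon> / \<beta> ^ n" if "y \<in> bad" for y
    proof (cases "y \<in> C")
      case True
      with a that have "a \<in> bad \<inter> C" by blast
      then have "same_cylinder \<beta> (n + N) a y"
        using True by (auto simp: C_def intro: same_cylinder_trans same_cylinder_sym)
      then show ?thesis using pair[of a y] \<open>a \<in> bad \<inter> C\<close> that by blast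
    next
      case False
      with b that have "b \<in> bad - C" by blast
      then show ?thesis using pair[of b y] other[of b y] that False by (auto simp: C_def)
    qed
    then show "\<exists>a b. \<forall>y\<in>{u..v}. y < 1 \<longrightarrow> (\<forall>i\<le>N. \<bar>(beta_map \<beta> ^^ (n + i)) y - x\<bar> < \<epsilon> \<longrightarrow>
        \<bar>y - a\<bar> \<le> 2 * \<epsilon> / \<beta> ^ n \<or> \<bar>y - b\<bar> \<le> 2 * \<epsilon> / \<beta> ^ n)"
      unfolding bad_def by blast
  qed
qed

section \<open>The game\<close>

text \<open>Three quarters of the interval can be placed with gaps of one eighth of its length. A
  ball has diameter at most one sixteenth, so each ball meets at most one of them.\<close>

lemma quarter_avoiding_two_balls:
  fixes u v a b r :: real
  assumes "u < v" "r \<le> (v - u) / 32"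
  obtains w where "u \<le> w" "w + 1 / 4 * (v - u) \<le> v"
    "\<And>y. y \<in> {w..w + 1 / 4 * (v - u)} \<Longrightarrow> \<not> \<bar>y - a\<bar> \<le> r \<and> \<not> \<bar>y - b\<bar> \<le> r"
proof -
  define L where "L = v - u"
  define free where "free w \<longleftrightarrow>
    (\<forall>y\<in>{w..w + 1 / 4 * L}. \<not> \<bar>y - a\<bar> \<le> r \<and> \<not> \<bar>y - b\<bar> \<le> r)" for w
  have r: "r \<le> L / 32" "0 < L" using assms by (auto simp: L_def)
  have "free u \<or> free (u + 3 / 8 * L) \<or> free (u + 3 / 4 * L)"
  proof (rule ccontr)
    assume "\<not> ?thesis"
    then obtain y1 y2 y3 where
      "y1 \<in> {u..u + 1 / 4 * L}" "\<bar>y1 - a\<bar> \<le> r \<or> \<bar>y1 - b\<bar> \<le> r"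
      "y2 \<in> {u + 3 / 8 * L..u + 3 / 8 * L + 1 / 4 * L}" "\<bar>y2 - a\<bar> \<le> r \<or> \<bar>y2 - b\<bar> \<le> r"
      "y3 \<in> {u + 3 / 4 * L..u + 3 / 4 * L + 1 / 4 * L}" "\<bar>y3 - a\<bar> \<le> r \<or> \<bar>y3 - b\<bar> \<le> r"
      unfolding free_def by blast
    moreover have "q - p \<le> 2 * r" if "\<bar>p - c\<bar> \<le> r" "\<bar>q - c\<bar> \<le> r" for p q c :: real
      using that by linarith
    moreover have "2 * r < y2 - y1" "2 * r < y3 - y2" "2 * r < y3 - y1"
      using calculation(1,3,5) r by auto
    ultimately show False by (meson not_le)
  qed
  then obtain w where "free w" "u \<le> w" "w + 1 / 4 * L \<le> u + L" using r(2) by force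
  then show ?thesis using that[of w] by (auto simp: free_def L_def)
qed

text \<open>
  The interval \<open>B\<^sub>k\<close> has length \<open>(\<alpha>\<gamma>)\<^sup>k\<bar>B\<^sub>0\<bar>\<close> in every play, so White's objective at step \<open>k\<close>
  needs to depend only on \<open>k\<close> and on the length \<open>l\<close> of \<open>B\<^sub>0\<close>.
\<close>
lemma game_winningI:
  assumes \<alpha>: "0 < \<alpha>"
    and ex: "\<And>l. 0 < l \<Longrightarrow> \<exists>Q. (\<forall>y. (\<forall>k. Q k y) \<longrightarrow> y \<in> E) \<and>
      (\<forall>k u v. 0 \<le> u \<longrightarrow> u < v \<longrightarrow> v \<le> 1 \<longrightarrow> v - u = (\<alpha> * \<gamma>) ^ k * l \<longrightarrow>
        (\<exists>w. u \<le> w \<and> w + \<alpha> * (v - u) \<le> v \<and> (\<forall>y\<in>{w..w + \<alpha> * (v - u)}. Q k y)))"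
  shows "game_winning \<alpha> \<gamma> E"
proof -
  \<comment> \<open>White learns l only from Black's first move, so objectives are chosen for all l
    at once.\<close>
  define P where "P l Q \<longleftrightarrow> (\<forall>y. (\<forall>k. Q k y) \<longrightarrow> y \<in> E) \<and>
      (\<forall>k u v. 0 \<le> u \<longrightarrow> u < v \<longrightarrow> v \<le> 1 \<longrightarrow> v - u = (\<alpha> * \<gamma>) ^ k * l \<longrightarrow>
        (\<exists>w. u \<le> w \<and> w + \<alpha> * (v - u) \<le> v \<and> (\<forall>y\<in>{w..w + \<alpha> * (v - u)}. Q k y)))" for l Q
  have "\<forall>l. \<exists>Q. 0 < l \<longrightarrow> P l Q" using ex unfolding P_def[symmetric] by blast
  from choice[OF this] obtain Q where Q: "\<And>l. 0 < l \<Longrightarrow> P l (Q l)" by blast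
  have Q_E: "y \<in> E" if "0 < l" "\<And>k. Q l k y" for l y
    using Q[OF that(1)] that(2) unfolding P_def by blast
  have Q_move: "\<exists>w. u \<le> w \<and> w + \<alpha> * (v - u) \<le> v \<and> (\<forall>y\<in>{w..w + \<alpha> * (v - u)}. Q l k y)"
    if "0 < l" "0 \<le> u" "u < v" "v \<le> 1" "v - u = (\<alpha> * \<gamma>) ^ k * l" for l k u v
    using Q[OF that(1)] that(2-) unfolding P_def by blast
  define len where "len J = measure lborel J" for J :: "real set"
  define good where "good l k J W \<longleftrightarrow> legal_move \<alpha> J W \<and> (\<forall>y\<in>W. Q l k y)" for l k J W
  \<comment> \<open>The history is [B 0, ..., B k]: its head gives l, its length minus one gives k,
    and its last entry is the interval to be answered.\<close>
  define \<sigma> where "\<sigma> h = (SOME W. good (len (hd h)) (length h - 1) (last h) W)" for h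
  have resp: "responses \<sigma> B k = (SOME W. good (len (B 0)) k (B k) W)" for B k
    by (simp add: responses_def \<sigma>_def hd_map upt_rec[of 0 "Suc k"] last_map del: upt_Suc)
  have len_ivl: "len {u..v} = v - u" if "u < v" for u v using that by (simp add: len_def)
  \<comment> \<open>The exact length of B k is carried along because a good answer is only known to
    exist for that length.\<close>
  have "closed_interval (B k) \<and> B k \<subseteq> {0..1} \<and> len (B k) = (\<alpha> * \<gamma>) ^ k * len (B 0) \<and>
      good (len (B 0)) k (B k) (responses \<sigma> B k)"
    if "\<forall>i\<le>k. black_move_legal \<gamma> B (responses \<sigma> B) i" for B k
    using that
  proof (induction k)
    have l: "0 < len (B 0)" if "black_move_legal \<gamma> B (responses \<sigma> B) 0"
      using that by (auto simp: closed_interval_def len_ivl)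
    have step: "good (len (B 0)) k (B k) (responses \<sigma> B k)"
      if "closed_interval (B k)" "B k \<subseteq> {0..1}" "len (B k) = (\<alpha> * \<gamma>) ^ k * len (B 0)"
        "black_move_legal \<gamma> B (responses \<sigma> B) 0" for k
    proof -
      obtain u v where uv: "u < v" "B k = {u..v}"
        using \<open>closed_interval (B k)\<close> by (auto simp: closed_interval_def)
      then have "0 \<le> u" "v \<le> 1" "v - u = (\<alpha> * \<gamma>) ^ k * len (B 0)"
        using that len_ivl[of u v] by auto
      from Q_move[OF l[OF that(4)] this(1) uv(1) this(2,3)] obtain w where
        w: "u \<le> w" "w + \<alpha> * (v - u) \<le> v" "\<forall>y\<in>{w..w + \<alpha> * (v - u)}. Q (len (B 0)) k y" by blast
      have "0 < \<alpha> * (v - u)" using \<alpha> uv by simp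
      then have "good (len (B 0)) k (B k) {w..w + \<alpha> * (v - u)}"
        using w uv by (auto simp: good_def legal_move_def closed_interval_def)
      then show ?thesis unfolding resp by (rule someI)
    qed
    {
      case 0
      then show ?case using step[of 0] by simp
    next
      case (Suc k)
      then have IH: "closed_interval (B k)" "B k \<subseteq> {0..1}" "len (B k) = (\<alpha> * \<gamma>) ^ k * len (B 0)"
        "good (len (B 0)) k (B k) (responses \<sigma> B k)" by auto
      have b: "legal_move \<gamma> (responses \<sigma> B k) (B (Suc k))" using Suc.prems by force
      have "closed_interval (B (Suc k))" "B (Suc k) \<subseteq> {0..1}"
        "len (B (Suc k)) = (\<alpha> * \<gamma>) ^ Suc k * len (B 0)"
        using b IH unfolding good_def legal_move_def len_def by auto
      moreover have "black_move_legal \<gamma> B (responses \<sigma> B) 0" using Suc.prems by blast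
      ultimately show ?case using step[of "Suc k"] by simp
    }
  qed
  then have key: "good (len (B 0)) k (B k) (responses \<sigma> B k)"
    if "\<forall>i\<le>k. black_move_legal \<gamma> B (responses \<sigma> B) i" for B k using that by blast
  show ?thesis unfolding game_winning_def
  proof (intro exI[of _ \<sigma>] allI conjI impI)
    fix B k assume "\<forall>i\<le>k. black_move_legal \<gamma> B (responses \<sigma> B) i"
    then show "legal_move \<alpha> (B k) (responses \<sigma> B k)" using key good_def by blast
  next
    fix B assume legal: "\<forall>k. black_move_legal \<gamma> B (responses \<sigma> B) k"
    then have "closed_interval (B 0)" by (metis black_move_legal.simps(1))
    then have "0 < len (B 0)" by (auto simp: closed_interval_def len_ivl)
    moreover have "\<forall>y\<in>responses \<sigma> B k. Q (len (B 0)) k y" for k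
      using key[of k B] legal by (simp add: good_def)
    ultimately show "(\<Inter>k. responses \<sigma> B k) \<subseteq> E" by (intro subsetI Q_E) auto
  qed
qed

section \<open>Objectives that keep the orbit away from the target\<close>

lemma power_bracket:
  fixes b c :: real
  assumes "1 < b" "1 \<le> c"
  obtains n where "b ^ n \<le> c" "c < b ^ Suc n"
proof -
  define m where "m = (LEAST m. c < b ^ m)"
  have m: "c < b ^ m" unfolding m_def using real_arch_pow[OF assms(1)] by (rule LeastI_ex)
  with assms have "m \<noteq> 0" by (cases m) auto
  then obtain n where n: "m = Suc n" using not0_implies_Suc by blast
  then have "\<not> c < b ^ n" using not_less_Least[of n "\<lambda>m. c < b ^ m"] by (simp add: m_def)
  with m n that show ?thesis by (metis not_less)
qed

lemma mem_orbit_avoiding_setI: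
  assumes "0 \<le> y" "y < 1" "0 < \<epsilon>" "\<And>n. \<epsilon> \<le> \<bar>(f ^^ n) y - x\<bar>"
  shows "y \<in> orbit_avoiding_set f x"
proof -
  have "x \<notin> closure (\<Union>n. {(f ^^ n) y})"
  proof
    assume "x \<in> closure (\<Union>n. {(f ^^ n) y})"
    then obtain n where "dist ((f ^^ n) y) x < \<epsilon>"
      using \<open>0 < \<epsilon>\<close> by (auto simp: closure_approachable)
    with assms(4)[of n] show False by (simp add: dist_real_def)
  qed
  with assms show ?thesis by (simp add: orbit_avoiding_set_def)
qed

text \<open>White waits until the intervals are short, then at each step excludes visits to x during
  one block of times. The blocks are cut by the powers of 1 / \<rho> and cover all times.\<close>

lemma quarter_winning:
  assumes \<beta>: "1 < \<beta>" "\<beta> < 2" and "expansion_of_one_terminates \<beta>"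
    and \<gamma>: "0 < \<gamma>" "\<gamma> < 1"
  shows "game_winning (1 / 4) \<gamma> (orbit_avoiding_set (beta_map \<beta>) x)"
proof (rule game_winningI)
  fix l :: real assume l: "0 < l"
  \<comment> \<open>The ratio of the lengths of consecutive intervals of Black.\<close>
  define \<rho> where "\<rho> = 1 / 4 * \<gamma>"
  have \<rho>: "0 < \<rho>" "\<rho> < 1" using \<gamma> by (auto simp: \<rho>_def)
  obtain N where N: "1 / \<rho> < \<beta> ^ N" using real_arch_pow[OF \<beta>(1)] by blast
  obtain \<eta> where \<eta>: "0 < \<eta>"
    "\<And>n u v \<epsilon>. 0 \<le> u \<Longrightarrow> u < v \<Longrightarrow> v \<le> 1 \<Longrightarrow> v - u \<le> \<eta> / \<beta> ^ n \<Longrightarrow> \<epsilon> < \<eta> \<Longrightarrow>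
      \<exists>a b. \<forall>y\<in>{u..v}. y < 1 \<longrightarrow> (\<forall>i\<le>Suc N. \<bar>(beta_map \<beta> ^^ (n + i)) y - x\<bar> < \<epsilon> \<longrightarrow>
        \<bar>y - a\<bar> \<le> 2 * \<epsilon> / \<beta> ^ n \<or> \<bar>y - b\<bar> \<le> 2 * \<epsilon> / \<beta> ^ n)"
    using bad_points_in_two_balls[OF assms(1-3), of "Suc N" x] by blast
  \<comment> \<open>The bound \<eta> / l makes B at step \<open>k\<^sub>0\<close> shorter than
    \<eta>. The bound 1 forces \<open>k\<^sub>0\<close> to be positive, leaving a waiting move in
    which White steers away from the point 1.\<close>
  obtain k\<^sub>0 where k0: "\<rho> ^ k\<^sub>0 < min 1 (\<eta> / l)"
    using real_arch_pow_inv[of "min 1 (\<eta> / l)" \<rho>] \<rho> \<eta> l by auto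
  then have "k\<^sub>0 \<noteq> 0" by (cases k\<^sub>0) auto
  define s where "s = \<rho> ^ k\<^sub>0 * l"
  have s: "0 < s" "s < \<eta>" using \<rho> l k0 by (auto simp: s_def field_simps)
  \<comment> \<open>At step \<open>k\<^sub>0 + j\<close> the balls have radius 2 * \<epsilon> /
    \<beta>^m, at most 4 * \<epsilon> * \<rho>^j; with 128 = 4 * 32 this is at most a 32nd of the
    interval.\<close>
  define \<epsilon> where "\<epsilon> = s / 128"
  have \<epsilon>: "0 < \<epsilon>" "\<epsilon> < \<eta>" using s by (auto simp: \<epsilon>_def)
  define Q where "Q k y \<longleftrightarrow> (if k < k\<^sub>0 then 0 \<le> y \<and> y < 1 else
    y < 1 \<longrightarrow> (\<forall>n. (1 / \<rho>) ^ (k - k\<^sub>0) \<le> \<beta> ^ n \<longrightarrow> \<beta> ^ n < (1 / \<rho>) ^ Suc (k - k\<^sub>0) \<longrightarrow>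
      \<epsilon> \<le> \<bar>(beta_map \<beta> ^^ n) y - x\<bar>))" for k y
  have Q_E: "y \<in> orbit_avoiding_set (beta_map \<beta>) x" if Q: "\<forall>k. Q k y" for y
  proof (rule mem_orbit_avoiding_setI[OF _ _ \<epsilon>(1)])
    show y: "0 \<le> y" "y < 1"
      using Q[THEN spec, of 0] \<open>k\<^sub>0 \<noteq> 0\<close> by (auto simp: Q_def)
    fix n
    obtain j where "(1 / \<rho>) ^ j \<le> \<beta> ^ n" "\<beta> ^ n < (1 / \<rho>) ^ Suc j"
      using power_bracket[of "1 / \<rho>" "\<beta> ^ n"] \<rho> \<beta> by auto
    then show "\<epsilon> \<le> \<bar>(beta_map \<beta> ^^ n) y - x\<bar>"
      using Q[THEN spec, of "k\<^sub>0 + j"] y by (simp add: Q_def)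
  qed
  have move: "\<exists>w. u \<le> w \<and> w + 1 / 4 * (v - u) \<le> v \<and> (\<forall>y\<in>{w..w + 1 / 4 * (v - u)}. Q k y)"
    if uv: "0 \<le> u" "u < v" "v \<le> 1" "v - u = \<rho> ^ k * l" for k u v
  proof (cases "k < k\<^sub>0")
    case True
    \<comment> \<open>The leftmost quarter does not reach \<open>v\<close>, hence not 1.\<close>
    then show ?thesis using uv by (intro exI[of _ u]) (auto simp: Q_def)
  next
    case False
    define j where "j = k - k\<^sub>0"
    have J: "v - u = \<rho> ^ j * s" using uv(4) False by (simp add: j_def s_def flip: power_add mult.assoc)
    have pos: "0 < \<rho> ^ j" "0 < \<beta> ^ n" for n using \<rho> \<beta> by auto
    have "1 \<le> (1 / \<rho>) ^ j" using \<rho> by (intro one_le_power) auto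
    then obtain m where m: "\<beta> ^ m \<le> (1 / \<rho>) ^ j" "(1 / \<rho>) ^ j < \<beta> ^ Suc m"
      using power_bracket[OF \<beta>(1)] by blast
    \<comment> \<open>Since \<beta> < 2, the numbers 1 / \<beta>^m and \<rho>^j agree up to a factor
      of 2.\<close>
    have "\<beta> ^ Suc m \<le> 2 * \<beta> ^ m" using \<beta> pos(2)[of m] by simp
    with m have p: "\<beta> ^ m \<le> 1 / \<rho> ^ j" "1 / \<rho> ^ j < 2 * \<beta> ^ m"
      by (simp_all only: power_one_over)
    then have m1: "\<rho> ^ j \<le> 1 / \<beta> ^ m" and m2: "1 / \<beta> ^ m \<le> 2 * \<rho> ^ j"
      using pos(1) pos(2)[of m] by (simp_all add: pos_le_divide_eq pos_divide_le_eq pos_divide_less_eq mult_ac)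
    have "v - u \<le> \<eta> / \<beta> ^ m"
      using mult_mono[of "\<rho> ^ j" "1 / \<beta> ^ m" s \<eta>] m1 J s \<beta> by simp
    from \<eta>(2)[OF uv(1-3) this \<epsilon>(2)] obtain a b where
      ab: "\<And>y i. y \<in> {u..v} \<Longrightarrow> y < 1 \<Longrightarrow> i \<le> Suc N \<Longrightarrow> \<bar>(beta_map \<beta> ^^ (m + i)) y - x\<bar> < \<epsilon> \<Longrightarrow>
        \<bar>y - a\<bar> \<le> 2 * \<epsilon> / \<beta> ^ m \<or> \<bar>y - b\<bar> \<le> 2 * \<epsilon> / \<beta> ^ m" by blast
    have "2 * \<epsilon> / \<beta> ^ m \<le> (v - u) / 32"
      using mult_left_mono[OF m2, of "2 * \<epsilon>"] \<epsilon>(1) J by (simp add: \<epsilon>_def algebra_simps)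
    from quarter_avoiding_two_balls[OF uv(2) this, of a b] obtain w where
      w: "u \<le> w" "w + 1 / 4 * (v - u) \<le> v" "\<And>y. y \<in> {w..w + 1 / 4 * (v - u)} \<Longrightarrow>
        \<not> \<bar>y - a\<bar> \<le> 2 * \<epsilon> / \<beta> ^ m \<and> \<not> \<bar>y - b\<bar> \<le> 2 * \<epsilon> / \<beta> ^ m" by blast
    have "Q k y" if y: "y \<in> {w..w + 1 / 4 * (v - u)}" for y
    proof -
      have "\<epsilon> \<le> \<bar>(beta_map \<beta> ^^ n) y - x\<bar>"
        if "y < 1" and n: "(1 / \<rho>) ^ j \<le> \<beta> ^ n" "\<beta> ^ n < (1 / \<rho>) ^ Suc j" for n
      proof -
        have "m \<le> n" using m(1) n(1) \<beta> by (meson order_trans power_increasing_iff)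
        \<comment> \<open>The block of times has ratio 1 / \<rho> < \<beta>^N, so it fits into the
          window starting at \<open>m\<close>.\<close>
        have "\<beta> ^ n < 1 / \<rho> * (1 / \<rho>) ^ j" using n(2) by simp
        also have "\<dots> \<le> \<beta> ^ N * \<beta> ^ Suc m"
          using N m(2) \<rho> pos(2)[of N] by (intro mult_mono) auto
        finally have "n < N + Suc m" using \<beta> by (simp only: power_strict_increasing_iff flip: power_add)
        then have "n = m + (n - m)" "n - m \<le> Suc N" using \<open>m \<le> n\<close> by auto
        moreover have "y \<in> {u..v}" using y w by auto
        ultimately show ?thesis using ab[of y "n - m"] w(3)[OF y] \<open>y < 1\<close> by force
      qed
      then show ?thesis using False by (simp add: Q_def j_def)
    qed
    then show ?thesis using w by blast
  qed
  show "\<exists>Q. (\<forall>y. (\<forall>k. Q k y) \<longrightarrow> y \<in> orbit_avoiding_set (beta_map \<beta>) x) \<and>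
      (\<forall>k u v. 0 \<le> u \<longrightarrow> u < v \<longrightarrow> v \<le> 1 \<longrightarrow> v - u = (1 / 4 * \<gamma>) ^ k * l \<longrightarrow>
        (\<exists>w. u \<le> w \<and> w + 1 / 4 * (v - u) \<le> v \<and> (\<forall>y\<in>{w..w + 1 / 4 * (v - u)}. Q k y)))"
    using Q_E move unfolding \<rho>_def by blast
qed simp

theorem theorem1p5:
  fixes \<beta> x :: real
  assumes "1 < \<beta>" and "\<beta> < 2"
    and "expansion_of_one_terminates \<beta>"
    and "0 \<le> x" and "x \<le> 1"
  shows "(\<exists>\<alpha>. 0 < \<alpha> \<and> \<alpha> < 1 \<and> alpha_winning \<alpha> (orbit_avoiding_set (beta_map \<beta>) x)) \<and>
         alpha_winning (1 / 4) (orbit_avoiding_set (beta_map \<beta>) x)"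
proof -
  have quarter: "alpha_winning (1 / 4) (orbit_avoiding_set (beta_map \<beta>) x)"
    using quarter_winning assms by (simp add: alpha_winning_def)
  moreover have "0 < (1 / 4 :: real)" "(1 / 4 :: real) < 1" by simp_all
  ultimately show ?thesis by blast
qed

end
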